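(* Let $\mathbb{D}$ be the dodecahedron graph, i.e., the graph formed by the $20$ vertices and $30$ edges of a regular dodecahedron. Then $k(\mathbb{D})=12$.
   Context: All graphs are simple and undirected. The competition graph $C(D)$ of a digraph $D$ is the graph with vertex set $V(D)$ in which two distinct vertices $x,y$ are adjacent if and only if there is a vertex $v$ with $(x,v)$ and $(y,v)$ both arcs of $D$. The competition number $k(G)$ of a graph $G$ is the minimum integer $k\ge 0$ such that $G$ together with $k$ new isolated vertices is the competition graph of some acyclic digraph. *)

theory Defs
  imports "HOL-Analysis.Analysis" "Graph_Theory.Pair_Digraph"
begin

text \<open>
  As in the \<^locale>\<open>pair_graph\<close> locale, a simple undirected graph is represented by the
  digraph that has both arcs \<open>(x, y)\<close> and \<open>(y, x)\<close> for every edge \<open>{x, y}\<close>.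
\<close>

definition competition_graph :: "'a pair_pre_digraph \<Rightarrow> 'a pair_pre_digraph" where
  "competition_graph D =
    \<lparr> pverts = pverts D,
      parcs = {(x, y). x \<in> pverts D \<and> y \<in> pverts D \<and> x \<noteq> y \<and>
        (\<exists>v \<in> pverts D. (x, v) \<in> parcs D \<and> (y, v) \<in> parcs D)} \<rparr>"

definition add_isolated :: "nat \<Rightarrow> 'a pair_pre_digraph \<Rightarrow> ('a + nat) pair_pre_digraph" where
  "add_isolated k G =
    \<lparr> pverts = Inl ` pverts G \<union> Inr ` {..<k},
      parcs = {(Inl x, Inl y) | x y. (x, y) \<in> parcs G} \<rparr>"

definition competition_number :: "'a pair_pre_digraph \<Rightarrow> nat" where
  "competition_number G =
    (LEAST k. \<exists>D. pair_digraph D \<and> acyclic (parcs D) \<and> competition_graph D = add_isolated k G)"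

definition golden_ratio :: real where
  "golden_ratio = (1 + sqrt 5) / 2"

text \<open>
  The regular dodecahedron of edge length \<open>2 / golden_ratio\<close> centred at the origin: the eight
  vertices \<open>(\<plusminus>1, \<plusminus>1, \<plusminus>1)\<close> of a cube, and the twelve cyclic permutations of
  \<open>(0, \<plusminus>golden_ratio, \<plusminus>1 / golden_ratio)\<close>.
\<close>

definition regular_dodecahedron :: "(real ^ 3) set" where
  "regular_dodecahedron = convex hull
    ({vector [a, b, c] | a b c. a \<in> {-1, 1} \<and> b \<in> {-1, 1} \<and> c \<in> {-1, 1}} \<union>
     {vector [0, a * golden_ratio, b / golden_ratio] | a b. a \<in> {-1, 1} \<and> b \<in> {-1, 1}} \<union>
     {vector [b / golden_ratio, 0, a * golden_ratio] | a b. a \<in> {-1, 1} \<and> b \<in> {-1, 1}} \<union>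
     {vector [a * golden_ratio, b / golden_ratio, 0] | a b. a \<in> {-1, 1} \<and> b \<in> {-1, 1}})"

definition polytope_graph :: "('a::euclidean_space) set \<Rightarrow> 'a pair_pre_digraph" where
  "polytope_graph P =
    \<lparr> pverts = {x. x extreme_point_of P},
      parcs = {(x, y). x extreme_point_of P \<and> y extreme_point_of P \<and> closed_segment x y edge_of P} \<rparr>"

definition dodecahedron_graph :: "(real ^ 3) pair_pre_digraph" where
  "dodecahedron_graph = polytope_graph regular_dodecahedron"

end

theory Submission
  imports Defs
begin

text \<open>
  In a triangle-free graph every common prey serves exactly one edge, and the first two vertices of
  an acyclic ordering serve none. Hence the number of edges is at most the number of vertices plus
  \<open>k - 2\<close>, which gives \<open>30 \<le> 20 + k - 2\<close> for the dodecahedron. Conversely, order a connected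
  graph so that every vertex after the first has an earlier neighbour. The edge that attaches a
  vertex to the earlier ones is assigned to the next vertex; this takes care of all but
  \<open>30 - 18 = 12\<close> edges.

  That the polytope graph is the expected one follows from inner products: the vertices lie on a
  sphere of squared radius \<open>3\<close>, the inner product of distinct vertices is at most \<open>sqrt 5\<close>, and two
  vertices \<open>v\<close>, \<open>w\<close> for which it equals \<open>sqrt 5\<close> are the only maximisers of \<open>(v + w) \<bullet> x\<close>. For all
  other pairs, \<open>v + w\<close> is twice a convex combination of further vertices.
\<close>

section \<open>Competition graphs and acyclic orderings\<close>

text \<open>Arcs come in opposite pairs, hence the factor 2. The predators of one vertex form a
  clique of the competition graph, so without triangles there are at most two of them and they
  account for at most two arcs. Summing over all vertices of \<open>D\<close> but two gives the
  bound.\<close>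

lemma card_parcs_le_if_competition_graph:
  assumes fin: "finite (pverts G)" and two: "2 \<le> card (pverts G)"
    and triangle_free: "\<And>x y z. (x, y) \<in> parcs G \<Longrightarrow> (y, z) \<in> parcs G \<Longrightarrow> (x, z) \<notin> parcs G"
    and D: "pair_digraph D" "acyclic (parcs D)" "competition_graph D = add_isolated k G"
  shows "card (parcs G) \<le> 2 * (card (pverts G) + k - 2)"
proof -
  interpret pair_digraph D by fact
  have verts_D: "pverts D = Inl ` pverts G \<union> Inr ` {..<k}"
    using D(3) by (simp add: competition_graph_def add_isolated_def)
  have card_D: "card (pverts D) = card (pverts G) + k"
    unfolding verts_D using fin by (subst card_Un_disjoint) (auto simp: card_image)
  have arcs_G: "parcs (competition_graph D) = (\<lambda>(x, y). (Inl x, Inl y)) ` parcs G"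
    unfolding D(3) by (auto simp: add_isolated_def)
  have card_arcs: "card (parcs (competition_graph D)) = card (parcs G)"
    unfolding arcs_G by (rule card_image) (auto simp: inj_on_def)
  define pred where "pred v = {x. (x, v) \<in> parcs D}" for v
  have pred_subset: "pred v \<subseteq> pverts D" for v
    using arc_fst_in_verts by (force simp: pred_def)
  have adjacent: "(x, y) \<in> parcs (competition_graph D)"
    if "x \<in> pred v" "y \<in> pred v" "x \<noteq> y" for x y v
    using that arc_fst_in_verts arc_snd_in_verts
    by (force simp: competition_graph_def pred_def)
  have card_pred: "card (pred v) \<le> 2" for v
  proof (rule ccontr)
    assume "\<not> card (pred v) \<le> 2"
    then obtain T where T: "T \<subseteq> pred v" "card T = 3"
      using obtain_subset_with_card_n[of 3 "pred v"] by auto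
    then obtain x y z where "T = {x, y, z}" "x \<noteq> y" "x \<noteq> z" "y \<noteq> z"
      by (auto simp: card_3_iff)
    with T have "(x, y) \<in> parcs (competition_graph D)" "(y, z) \<in> parcs (competition_graph D)"
      "(x, z) \<in> parcs (competition_graph D)"
      using adjacent[of x v y] adjacent[of y v z] adjacent[of x v z] by auto
    then show False
      unfolding arcs_G using triangle_free by auto
  qed
  \<comment> \<open>Well-foundedness yields a source \<open>s\<close> of \<open>D\<close>, and then
    a source \<open>t\<close> of what remains after deleting \<open>s\<close>.\<close>
  have wf: "wf (parcs D)"
    using D(2) pair_finite_arcs by (rule finite_acyclic_wf[rotated])
  have "pverts D \<noteq> {}"
    using card_D two by auto
  then obtain s where s: "s \<in> pverts D" "\<And>y. (y, s) \<in> parcs D \<Longrightarrow> y \<notin> pverts D"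
    using wf by (meson ex_in_conv wfE_min)
  have "\<not> pverts D \<subseteq> {s}"
    using card_D two card_mono[of "{s}" "pverts D"] by auto
  then obtain t0 where "t0 \<in> pverts D - {s}"
    by blast
  then obtain t where t: "t \<in> pverts D - {s}"
    "\<And>y. (y, t) \<in> parcs D \<Longrightarrow> y \<notin> pverts D - {s}"
    using wf by (metis wfE_min)
  \<comment> \<open>In an acyclic ordering, the first vertex has no predator and the second at most one.\<close>
  have "pred s = {}" "pred t \<subseteq> {s}"
    using s(2) t(2) pred_subset by (auto simp: pred_def)
  then have "v \<in> pverts D - {s, t}" if "v \<in> pverts D" "x \<in> pred v" "y \<in> pred v" "x \<noteq> y" for v x y
    using that by auto
  then have "parcs (competition_graph D) \<subseteq> (\<Union>v \<in> pverts D - {s, t}. pred v \<times> pred v - Id)"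
    by (simp add: competition_graph_def pred_def) blast
  moreover have fin_pred: "finite (pred v)" for v
    using pred_subset pair_finite_verts finite_subset by blast
  ultimately have "card (parcs (competition_graph D))
      \<le> card (\<Union>v \<in> pverts D - {s, t}. pred v \<times> pred v - Id)"
    using pair_finite_verts by (intro card_mono) auto
  also have "\<dots> \<le> (\<Sum>v \<in> pverts D - {s, t}. card (pred v \<times> pred v - Id))"
    using pair_finite_verts by (intro card_UN_le) auto
  also have "\<dots> \<le> (\<Sum>v \<in> pverts D - {s, t}. 2)"
  proof (rule sum_mono)
    fix v
    have "card (pred v) = 0 \<or> card (pred v) = 1 \<or> card (pred v) = 2"
      using card_pred[of v] by linarith
    then have "\<exists>a b. pred v \<subseteq> {a, b}"
      using fin_pred[of v] by (auto simp: card_1_singleton_iff card_2_iff)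
    then obtain a b where "pred v \<subseteq> {a, b}"
      by blast
    then have "pred v \<times> pred v - Id \<subseteq> {(a, b), (b, a)}"
      by auto
    then have "card (pred v \<times> pred v - Id) \<le> card {(a, b), (b, a)}"
      by (intro card_mono) auto
    also have "\<dots> \<le> 2"
      by (cases "a = b") simp_all
    finally show "card (pred v \<times> pred v - Id) \<le> 2" .
  qed
  also have "\<dots> = 2 * (card (pverts G) + k - 2)"
    using s(1) t(1) card_D pair_finite_verts card_2_iff[of "{s, t}"]
    by (auto simp: card_Diff_subset)
  finally show ?thesis
    by (simp add: card_arcs)
qed

text \<open>The attaching edges of all vertices but the first and the last use old vertices as prey,
  which saves \<open>n - 2\<close> new vertices; each other edge gets a new one. Different edges
  have different prey, so no unwanted adjacency arises.\<close>

lemma competition_graph_if_connected_ordering: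
  fixes f :: "nat \<Rightarrow> 'a"
  assumes bij: "bij_betw f {..<n} (pverts G)"
    and arcs_subset: "parcs G \<subseteq> pverts G \<times> pverts G"
    and sym_G: "\<And>x y. (x, y) \<in> parcs G \<Longrightarrow> (y, x) \<in> parcs G"
    and loopfree: "\<And>x. (x, x) \<notin> parcs G"
    and earlier: "\<And>i. 0 < i \<Longrightarrow> i < n \<Longrightarrow> \<exists>j<i. (f j, f i) \<in> parcs G"
    and card_E: "card {(i, j). i < j \<and> j < n \<and> (f i, f j) \<in> parcs G} + 2 = n + k" and "2 \<le> n"
  shows "\<exists>D. pair_digraph D \<and> acyclic (parcs D) \<and> competition_graph D = add_isolated k G"
proof -
  define E where "E = {(i, j). i < j \<and> j < n \<and> (f i, f j) \<in> parcs G}"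
  have inj: "f i = f j \<longleftrightarrow> i = j" if "i < n" "j < n" for i j
    using bij that by (auto simp: bij_betw_def inj_on_def)
  have verts_G: "pverts G = f ` {..<n}"
    using bij by (auto simp: bij_betw_def)
  have "finite E"
    by (rule finite_subset[of _ "{..<n} \<times> {..<n}"]) (auto simp: E_def)
  obtain p where p: "\<And>i. 0 < i \<Longrightarrow> i < n \<Longrightarrow> p i < i \<and> (f (p i), f i) \<in> parcs G"
    using earlier by metis
  \<comment> \<open>The index \<open>n - 1\<close> is left out because the last vertex has no
    successor to serve as prey; its attaching edge falls into \<open>E - T\<close>.\<close>
  define T where "T = (\<lambda>i. (p i, i)) ` {1..<n - 1}"
  have "T \<subseteq> E"
    using p by (auto simp: T_def E_def)
  moreover have "card T = n - 2"
    unfolding T_def by (subst card_image) (auto simp: inj_on_def)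
  ultimately have card_R: "card (E - T) = k"
    using card_E \<open>finite E\<close> \<open>2 \<le> n\<close> by (simp add: card_Diff_subset finite_subset E_def)
  obtain h where "bij_betw h {0..<k} (E - T)"
    using ex_bij_betw_nat_finite[of "E - T"] \<open>finite E\<close> card_R by blast
  then have h: "h ` {..<k} = E - T"
    by (simp add: bij_betw_def lessThan_atLeast0)
  define pair where "pair = (\<lambda>(c, d). {Inl (f c), Inl (f d) :: 'a + nat})"
  \<comment> \<open>The edge from \<open>f i\<close> back to \<open>f (p i)\<close> gets the next vertex \<open>f (Suc i)\<close> as its prey,
    and the edges left over get the new vertices.\<close>
  define A where "A = {(x, Inl (f (Suc i))) | x i. 0 < i \<and> Suc i < n \<and> x \<in> pair (p i, i)} \<union>
    {(x, Inr j) | x j. j < k \<and> x \<in> pair (h j)}"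
  define D where "D = \<lparr>pverts = Inl ` pverts G \<union> Inr ` {..<k}, parcs = A\<rparr>"
  have h_E: "h j \<in> E" if "j < k" for j
    using h that by auto
  have pair_verts: "pair e \<subseteq> Inl ` pverts G" if "e \<in> E" for e
    using that by (auto simp: pair_def E_def verts_G)
  have p_E: "(p i, i) \<in> E" if "0 < i" "i < n" for i
    using p that by (auto simp: E_def)
  \<comment> \<open>The position in the ordering, with all new vertices placed at the end, strictly
    increases along arcs. This gives acyclicity and the absence of loops.\<close>
  define rank :: "'a + nat \<Rightarrow> nat" where "rank = case_sum (inv_into {..<n} f) (\<lambda>_. n)"
  have rank_f: "rank (Inl (f i)) = i" if "i < n" for i
    using bij that by (simp add: rank_def bij_betw_def)
  have rank_A: "rank x < rank y" if "(x, y) \<in> A" for x y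
    using that unfolding A_def
  proof (elim UnE)
    assume "(x, y) \<in> {(x, Inl (f (Suc i))) | x i. 0 < i \<and> Suc i < n \<and> x \<in> pair (p i, i)}"
    then obtain i where "0 < i" "Suc i < n" "y = Inl (f (Suc i))" "x \<in> pair (p i, i)"
      by blast
    with p[of i] show ?thesis
      by (auto simp: pair_def rank_f)
  next
    assume "(x, y) \<in> {(x, Inr j) | x j. j < k \<and> x \<in> pair (h j)}"
    then obtain j where "j < k" "y = Inr j" "x \<in> pair (h j)"
      by blast
    with h_E[of j] show ?thesis
      by (auto simp: pair_def E_def rank_f, auto simp: rank_def)
  qed
  have A_subset: "A \<subseteq> pverts D \<times> pverts D"
  proof (clarsimp simp: A_def, intro conjI; clarsimp)
    show "x \<in> pverts D \<and> Inl (f (Suc i)) \<in> pverts D"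
      if "0 < i" "Suc i < n" "x \<in> pair (p i, i)" for x i
      using pair_verts[OF p_E[of i]] that by (auto simp: D_def verts_G)
    show "x \<in> pverts D \<and> Inr j \<in> pverts D" if "j < k" "x \<in> pair (h j)" for x j
      using pair_verts[OF h_E[of j]] that by (auto simp: D_def)
  qed
  have "finite (pverts D)"
    by (simp add: D_def verts_G)
  moreover have "finite A"
    using A_subset calculation finite_subset by blast
  ultimately have "pair_digraph D"
    using A_subset by unfold_locales (auto simp: D_def dest: rank_A)
  moreover have "acyclic (parcs D)"
  proof -
    have "A \<subseteq> Wellfounded.measure rank"
      using rank_A by auto
    then show ?thesis
      by (simp add: D_def wf_acyclic wf_subset[OF wf_measure])
  qed
  moreover have "competition_graph D = add_isolated k G"
  proof -
    have common_prey: "\<exists>v. \<forall>x \<in> pair e. (x, v) \<in> A" if "e \<in> E" for e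
    proof (cases "e \<in> T")
      case True
      then obtain i where "e = (p i, i)" "0 < i" "Suc i < n"
        by (auto simp: T_def)
      then show ?thesis
        by (auto simp: A_def)
    next
      case False
      then have "e \<in> h ` {..<k}"
        using that by (simp add: h)
      then obtain j where "j < k" "e = h j"
        by auto
      then show ?thesis
        by (auto simp: A_def)
    qed
    \<comment> \<open>Each prey belongs to one edge only: an old vertex \<open>f (Suc i)\<close>
      determines \<open>i\<close>, and a new vertex \<open>Inr j\<close> determines
      \<open>h j\<close>.\<close>
    have prey_edge: "\<exists>e \<in> E. x \<in> pair e \<and> y \<in> pair e" if xy: "(x, v) \<in> A" "(y, v) \<in> A" for x y v
    proof (cases v)
      case (Inl w)
      then obtain i j where "0 < i" "Suc i < n" "w = f (Suc i)" "x \<in> pair (p i, i)"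
        "Suc j < n" "w = f (Suc j)" "y \<in> pair (p j, j)"
        using xy by (auto simp: A_def)
      moreover from this have "i = j"
        using inj[of "Suc i" "Suc j"] by auto
      ultimately show ?thesis
        using p_E[of i] by auto
    next
      case (Inr j)
      then show ?thesis
        using xy h_E[of j] by (auto simp: A_def)
    qed
    have "(x, y) \<in> parcs (competition_graph D) \<longleftrightarrow> (x, y) \<in> parcs (add_isolated k G)" for x y
    proof
      assume "(x, y) \<in> parcs (competition_graph D)"
      then obtain v where "x \<noteq> y" "(x, v) \<in> A" "(y, v) \<in> A"
        by (auto simp: competition_graph_def D_def)
      then obtain c d where "(c, d) \<in> E" "x \<in> pair (c, d)" "y \<in> pair (c, d)"
        using prey_edge by (metis surj_pair)
      with \<open>x \<noteq> y\<close> show "(x, y) \<in> parcs (add_isolated k G)"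
        using sym_G by (auto simp: E_def pair_def add_isolated_def)
    next
      assume "(x, y) \<in> parcs (add_isolated k G)"
      then obtain u w where uw: "x = Inl u" "y = Inl w" "(u, w) \<in> parcs G"
        by (auto simp: add_isolated_def)
      then obtain a b where ab: "a < n" "b < n" "u = f a" "w = f b"
        using arcs_subset by (auto simp: verts_G)
      have "a \<noteq> b"
        using uw ab loopfree by auto
      \<comment> \<open>\<open>E\<close> contains each edge once, with the smaller index
        first.\<close>
      then have "(min a b, max a b) \<in> E"
        using uw ab sym_G by (auto simp: E_def min_def max_def)
      moreover have "x \<in> pair (min a b, max a b)" "y \<in> pair (min a b, max a b)"
        using uw ab by (auto simp: pair_def min_def max_def)
      ultimately obtain v where "(x, v) \<in> A" "(y, v) \<in> A"
        using common_prey by blast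
      then show "(x, y) \<in> parcs (competition_graph D)"
        using A_subset uw loopfree by (auto simp: competition_graph_def D_def)
    qed
    then have "parcs (competition_graph D) = parcs (add_isolated k G)"
      by auto
    then show ?thesis
      by (simp add: competition_graph_def add_isolated_def D_def)
  qed
  ultimately show ?thesis
    by blast
qed

section \<open>Faces of the convex hull of points on a sphere\<close>

text \<open>The section of the hull by the hyperplane is a face, hence the hull of some part of
  \<open>S\<close>. That part lies in the hyperplane, so it consists of points of \<open>S\<close>
  that attain the bound.\<close>

lemma convex_hull_face_of_supporting_hyperplane:
  fixes S :: "'a::euclidean_space set"
  assumes "finite S" and le: "\<And>x. x \<in> S \<Longrightarrow> a \<bullet> x \<le> b"
  shows "convex hull {x \<in> S. a \<bullet> x = b} face_of convex hull S"
proof -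
  let ?F = "convex hull S \<inter> {x. a \<bullet> x = b}"
  have "convex hull S \<subseteq> {x. a \<bullet> x \<le> b}"
    using le by (intro hull_minimal) (auto simp: convex_halfspace_le)
  then have face: "?F face_of convex hull S"
    by (intro face_of_Int_supporting_hyperplane_le) auto
  then obtain S' where S': "S' \<subseteq> S" "?F = convex hull S'"
    using face_of_convex_hull_subset finite_imp_compact[OF \<open>finite S\<close>] by blast
  have "S' \<subseteq> ?F"
    unfolding S'(2) by (rule hull_subset)
  with S'(1) have "S' \<subseteq> {x \<in> S. a \<bullet> x = b}"
    by auto
  then have "?F \<subseteq> convex hull {x \<in> S. a \<bullet> x = b}"
    unfolding S'(2) by (rule hull_mono)
  moreover have "convex hull {x \<in> S. a \<bullet> x = b} \<subseteq> ?F"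
    by (intro hull_minimal) (auto simp: hull_inc convex_Int convex_hyperplane)
  ultimately show ?thesis
    using face by (metis subset_antisym)
qed

lemma inner_less_on_sphere:
  fixes x y :: "'a::real_inner"
  assumes "x \<bullet> x = r" "y \<bullet> y = r" "x \<noteq> y"
  shows "x \<bullet> y < r"
proof -
  have "0 < (x - y) \<bullet> (x - y)"
    using assms by simp
  then show ?thesis
    using assms by (simp add: inner_diff inner_commute)
qed

text \<open>Each \<open>v\<close> in \<open>S\<close> is exposed by the functional \<open>v\<close>
  itself: its value \<open>r\<close> at \<open>v\<close> is not reached at any other point of
  \<open>S\<close>.\<close>

lemma extreme_points_of_convex_hull_sphere:
  fixes S :: "'a::euclidean_space set"
  assumes "finite S" and sphere: "\<And>x. x \<in> S \<Longrightarrow> x \<bullet> x = r"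
  shows "{x. x extreme_point_of convex hull S} = S"
proof
  show "{x. x extreme_point_of convex hull S} \<subseteq> S"
    using extreme_point_of_convex_hull by blast
  show "S \<subseteq> {x. x extreme_point_of convex hull S}"
  proof
    fix v assume v: "v \<in> S"
    have less: "v \<bullet> x < r" if "x \<in> S" "x \<noteq> v" for x
      using inner_less_on_sphere sphere v that by metis
    then have "{x \<in> S. v \<bullet> x = r} = {v}"
      using v sphere by fastforce
    moreover have "v \<bullet> x \<le> r" if "x \<in> S" for x
      using less[of x] sphere that by fastforce
    ultimately have "{v} face_of convex hull S"
      using convex_hull_face_of_supporting_hyperplane[OF \<open>finite S\<close>, of v r] by simp
    then show "v \<in> {x. x extreme_point_of convex hull S}"
      by (simp add: face_of_singleton)
  qed
qed

text \<open>The functional \<open>v + w\<close> takes the value \<open>r + v \<bullet> w\<close> at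
  both end points, so \<open>less\<close> makes them its only maximisers on
  \<open>S\<close>.\<close>

lemma closed_segment_edge_of_convex_hull_sphere:
  fixes S :: "'a::euclidean_space set"
  assumes "finite S" and sphere: "\<And>x. x \<in> S \<Longrightarrow> x \<bullet> x = r"
    and vw: "v \<in> S" "w \<in> S" "v \<noteq> w"
    and less: "\<And>x. x \<in> S \<Longrightarrow> x \<noteq> v \<Longrightarrow> x \<noteq> w \<Longrightarrow> (v + w) \<bullet> x < r + v \<bullet> w"
  shows "closed_segment v w edge_of convex hull S"
proof -
  have eq: "(v + w) \<bullet> v = r + v \<bullet> w" "(v + w) \<bullet> w = r + v \<bullet> w"
    using sphere vw by (simp_all add: inner_add_left inner_commute[of w v])
  have "{x \<in> S. (v + w) \<bullet> x = r + v \<bullet> w} = {v, w}"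
    using less eq vw by fastforce
  moreover have "(v + w) \<bullet> x \<le> r + v \<bullet> w" if "x \<in> S" for x
    using less[OF that] eq by fastforce
  ultimately have "convex hull {v, w} face_of convex hull S"
    using convex_hull_face_of_supporting_hyperplane[OF \<open>finite S\<close>, of "v + w" "r + v \<bullet> w"] by simp
  moreover have "aff_dim (convex hull {v, w}) = 1"
    using vw by (simp add: aff_dim_convex_hull)
  ultimately show ?thesis
    by (simp add: edge_of_def segment_convex_hull)
qed

text \<open>A linear functional that exposes the segment would be strictly larger at \<open>v\<close> and \<open>w\<close>
  than at the other four points.\<close>

lemma not_closed_segment_edge_of_convex_hull:
  fixes S :: "'a::euclidean_space set"
  assumes "finite S" and sphere: "\<And>x. x \<in> S \<Longrightarrow> x \<bullet> x = r"
    and vw: "v \<in> S" "w \<in> S" and others: "{p, q, s, t} \<subseteq> S - {v, w}"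
    and c: "0 < c" "c < 1" and eq: "v + w = (1 - c) *\<^sub>R (p + q) + c *\<^sub>R (s + t)"
  shows "\<not> closed_segment v w edge_of convex hull S"
proof
  assume "closed_segment v w edge_of convex hull S"
  \<comment> \<open>Faces of a polyhedron are exposed, which supplies a functional \<open>a\<close>
    whose maximum \<open>b\<close> is attained exactly on the segment.\<close>
  moreover have "polyhedron (convex hull S)"
    using \<open>finite S\<close> by (intro polytope_imp_polyhedron) (auto simp: polytope_def)
  ultimately have "closed_segment v w exposed_face_of convex hull S"
    by (simp add: edge_of_def exposed_face_of_polyhedron)
  then obtain a b where le: "convex hull S \<subseteq> {x. a \<bullet> x \<le> b}"
    and seg: "closed_segment v w = convex hull S \<inter> {x. a \<bullet> x = b}"
    by (auto simp: exposed_face_of_def)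
  \<comment> \<open>A further point of \<open>S\<close> is extreme in the hull, so it does not lie
    on the segment, and \<open>a\<close> stays below \<open>b\<close> there.\<close>
  have less: "a \<bullet> x < b" if "x \<in> S - {v, w}" for x
  proof -
    have "x extreme_point_of convex hull S"
      using extreme_points_of_convex_hull_sphere[OF \<open>finite S\<close> sphere] that by blast
    then have "x \<notin> open_segment v w"
      using vw by (auto simp: extreme_point_of_def hull_inc)
    then have "x \<notin> closed_segment v w"
      using that by (simp add: closed_segment_eq_open)
    moreover have "x \<in> convex hull S"
      using that by (simp add: hull_inc)
    ultimately show ?thesis
      using le seg by fastforce
  qed
  have "a \<bullet> v = b" "a \<bullet> w = b"
    using seg by (metis IntD2 ends_in_segment mem_Collect_eq)+
  then have "2 * b = a \<bullet> (v + w)"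
    by (simp add: inner_add_right)
  also have "\<dots> = (1 - c) * (a \<bullet> p + a \<bullet> q) + c * (a \<bullet> s + a \<bullet> t)"
    by (simp only: eq inner_add_right inner_scaleR_right)
  also have "\<dots> < (1 - c) * (2 * b) + c * (2 * b)"
    using less[of p] less[of q] less[of s] less[of t] others c
    by (intro add_strict_mono mult_strict_left_mono) auto
  finally show False
    by (simp add: algebra_simps)
qed

section \<open>The vertices of the dodecahedron in coordinates\<close>

text \<open>Integer pairs make the ring Z[golden ratio] executable. All coordinates and inner
  products of the vertices lie in it, so identities between them can be checked by
  evaluation.\<close>

definition golden_int :: "int \<times> int \<Rightarrow> real" where
  "golden_int = (\<lambda>(a, b). of_int a + of_int b * golden_ratio)"

definition golden_add :: "int \<times> int \<Rightarrow> int \<times> int \<Rightarrow> int \<times> int" where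
  "golden_add = (\<lambda>(a, b) (c, d). (a + c, b + d))"

text \<open>The square of the golden ratio is reduced by \<open>golden_ratio_square\<close>.\<close>

definition golden_mult :: "int \<times> int \<Rightarrow> int \<times> int \<Rightarrow> int \<times> int" where
  "golden_mult = (\<lambda>(a, b) (c, d). (a * c + b * d, a * d + b * c + b * d))"

lemma golden_ratio_square: "golden_ratio * golden_ratio = golden_ratio + 1"
  by (simp add: golden_ratio_def field_simps)

lemma golden_ratio_bounds: "1 < golden_ratio" "golden_ratio < 2"
proof -
  have "sqrt 1 < sqrt 5" "sqrt 5 < sqrt 9"
    by (subst real_sqrt_less_iff; simp)+
  moreover have "sqrt 9 = sqrt (3 ^ 2)"
    by simp
  then have "sqrt 9 = 3"
    by (simp only: real_sqrt_abs)
  ultimately show "1 < golden_ratio" "golden_ratio < 2"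
    by (simp_all add: golden_ratio_def)
qed

text \<open>Removing the division places the coordinates of the vertices in Z[golden ratio].\<close>

lemma inverse_golden_ratio: "x / golden_ratio = x * (golden_ratio - 1)"
proof -
  have "(golden_ratio - 1) * golden_ratio = 1"
    by (simp add: left_diff_distrib golden_ratio_square)
  then have "x * (golden_ratio - 1) * golden_ratio = x"
    by (simp only: mult.assoc mult_1_right)
  then show ?thesis
    using golden_ratio_bounds(1) by (simp only: divide_eq_eq) simp
qed

lemma golden_int_add: "golden_int (golden_add x y) = golden_int x + golden_int y"
  by (auto simp: golden_int_def golden_add_def algebra_simps split: prod.splits)

lemma golden_int_mult: "golden_int (golden_mult x y) = golden_int x * golden_int y"
proof -
  obtain a b c d where "x = (a, b)" "y = (c, d)"
    by (metis surj_pair)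
  moreover have "(real_of_int b * golden_ratio) * (real_of_int d * golden_ratio)
      = real_of_int b * real_of_int d * (golden_ratio + 1)"
    using golden_ratio_square by (metis mult.assoc mult.left_commute)
  ultimately show ?thesis
    by (simp add: golden_int_def golden_mult_def algebra_simps)
qed

type_synonym golden_vec = "(int \<times> int) \<times> (int \<times> int) \<times> (int \<times> int)"

definition golden_point :: "golden_vec \<Rightarrow> real ^ 3" where
  "golden_point = (\<lambda>(x, y, z). vector [golden_int x, golden_int y, golden_int z])"

definition golden_vec_add :: "golden_vec \<Rightarrow> golden_vec \<Rightarrow> golden_vec" where
  "golden_vec_add = (\<lambda>(x, y, z) (x', y', z'). (golden_add x x', golden_add y y', golden_add z z'))"

definition golden_scale :: "int \<times> int \<Rightarrow> golden_vec \<Rightarrow> golden_vec" where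
  "golden_scale c = (\<lambda>(x, y, z). (golden_mult c x, golden_mult c y, golden_mult c z))"

definition golden_inner :: "golden_vec \<Rightarrow> golden_vec \<Rightarrow> int \<times> int" where
  "golden_inner = (\<lambda>(x, y, z) (x', y', z').
    golden_add (golden_mult x x') (golden_add (golden_mult y y') (golden_mult z z')))"

lemma golden_point_add:
  "golden_point (golden_vec_add u v) = golden_point u + golden_point v"
  by (cases u rule: prod_cases3; cases v rule: prod_cases3)
    (simp add: golden_point_def golden_vec_add_def golden_int_add vec_eq_iff forall_3)

lemma golden_point_scale: "golden_point (golden_scale c v) = golden_int c *\<^sub>R golden_point v"
  by (cases v rule: prod_cases3)
    (simp add: golden_point_def golden_scale_def golden_int_mult vec_eq_iff forall_3)

lemma golden_point_inner: "golden_point u \<bullet> golden_point v = golden_int (golden_inner u v)"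
  by (cases u rule: prod_cases3; cases v rule: prod_cases3)
    (simp add: golden_point_def golden_inner_def golden_int_add golden_int_mult inner_vec_def sum_3)

lemma golden_inner_commute: "golden_inner u v = golden_inner v u"
proof -
  have "golden_mult x y = golden_mult y x" for x y
    by (cases x; cases y) (simp add: golden_mult_def mult.commute add.commute)
  then show ?thesis
    by (cases u rule: prod_cases3; cases v rule: prod_cases3) (simp add: golden_inner_def)
qed

text \<open>Breadth-first order: every vertex after the first has an earlier neighbour.\<close>

definition dodecahedron_coords :: "golden_vec list" where
  "dodecahedron_coords =
    [((1, 0), (1, 0), (1, 0)), ((0, 0), (0, 1), (-1, 1)),
     ((-1, 1), (0, 0), (0, 1)), ((0, 1), (-1, 1), (0, 0)),
     ((-1, 0), (1, 0), (1, 0)), ((0, 0), (0, 1), (1, -1)),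
     ((1, 0), (-1, 0), (1, 0)), ((1, -1), (0, 0), (0, 1)),
     ((1, 0), (1, 0), (-1, 0)), ((0, 1), (1, -1), (0, 0)),
     ((0, -1), (-1, 1), (0, 0)), ((-1, 0), (1, 0), (-1, 0)),
     ((0, 0), (0, -1), (-1, 1)), ((-1, 0), (-1, 0), (1, 0)),
     ((-1, 1), (0, 0), (0, -1)), ((1, 0), (-1, 0), (-1, 0)),
     ((0, -1), (1, -1), (0, 0)), ((1, -1), (0, 0), (0, -1)),
     ((0, 0), (0, -1), (1, -1)), ((-1, 0), (-1, 0), (-1, 0))]"

definition dodecahedron_vertex :: "nat \<Rightarrow> real ^ 3" where
  "dodecahedron_vertex i = golden_point (dodecahedron_coords ! i)"

definition vertex_inner :: "nat \<Rightarrow> nat \<Rightarrow> int \<times> int" where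
  "vertex_inner i j = golden_inner (dodecahedron_coords ! i) (dodecahedron_coords ! j)"

text \<open>Adjacent vertices are those with inner product \<open>sqrt 5 = 2 * golden_ratio - 1\<close>.\<close>

definition vertex_adj :: "nat \<Rightarrow> nat \<Rightarrow> bool" where
  "vertex_adj i j \<longleftrightarrow> vertex_inner i j = (-1, 2)"

lemma inner_dodecahedron_vertex:
  "dodecahedron_vertex i \<bullet> dodecahedron_vertex j = golden_int (vertex_inner i j)"
  by (simp add: dodecahedron_vertex_def vertex_inner_def golden_point_inner)

lemma vertex_adj_sym: "vertex_adj i j \<longleftrightarrow> vertex_adj j i"
  by (simp add: vertex_adj_def vertex_inner_def golden_inner_commute)

lemma regular_dodecahedron_eq:
  "regular_dodecahedron = convex hull (dodecahedron_vertex ` {..<20})"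
proof -
  have "dodecahedron_vertex ` {..<20} = golden_point ` set dodecahedron_coords"
  proof -
    have "set dodecahedron_coords = (!) dodecahedron_coords ` {..<20}"
      by (simp add: set_conv_nth dodecahedron_coords_def) auto
    then show ?thesis
      by (simp add: image_image dodecahedron_vertex_def[abs_def])
  qed
  also have "\<dots> = {vector [a, b, c] | a b c. a \<in> {-1, 1} \<and> b \<in> {-1, 1} \<and> c \<in> {-1, 1}} \<union>
     {vector [0, a * golden_ratio, b / golden_ratio] | a b. a \<in> {-1, 1} \<and> b \<in> {-1, 1}} \<union>
     {vector [b / golden_ratio, 0, a * golden_ratio] | a b. a \<in> {-1, 1} \<and> b \<in> {-1, 1}} \<union>
     {vector [a * golden_ratio, b / golden_ratio, 0] | a b. a \<in> {-1, 1} \<and> b \<in> {-1, 1}}"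
    (is "_ = ?A1 \<union> ?A2 \<union> ?A3 \<union> ?A4")
  proof -
    \<comment> \<open>As images of products of \<open>{-1, 1}\<close>, the four families can be
      expanded into the twenty explicit points.\<close>
    have image3: "{g a b c | a b c. a \<in> A \<and> b \<in> B \<and> c \<in> C} = (\<lambda>(a, b, c). g a b c) ` (A \<times> B \<times> C)"
      for g :: "real \<Rightarrow> real \<Rightarrow> real \<Rightarrow> real ^ 3" and A B C
      by (auto intro: image_eqI[where x = "(a, b, c)" for a b c])
    have image2: "{g a b | a b. a \<in> A \<and> b \<in> B} = (\<lambda>(a, b). g a b) ` (A \<times> B)"
      for g :: "real \<Rightarrow> real \<Rightarrow> real ^ 3" and A B
      by auto
    have times: "{-1, 1 :: real} \<times> A = Pair (-1) ` A \<union> Pair 1 ` A" for A :: "'b set"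
      by auto
    show ?thesis
      unfolding image3 image2
      by (simp add: times dodecahedron_coords_def golden_point_def golden_int_def
          inverse_golden_ratio image_Un) blast
  qed
  finally show ?thesis
    by (simp add: regular_dodecahedron_def)
qed

section \<open>The graph of the dodecahedron\<close>

text \<open>Besides 3 and \<open>sqrt 5\<close>, the only inner products are 1, -1,
  \<open>- sqrt 5\<close> (encoded by \<open>(1, -2)\<close>) and -3; evaluation runs through all
  index pairs.\<close>

lemma vertex_inner_cases:
  assumes "i < 20" "j < 20"
  shows "if i = j then vertex_inner i j = (3, 0)
    else vertex_adj i j \<or> vertex_inner i j \<in> {(1, 0), (-1, 0), (1, -2), (-3, 0)}"
proof -
  have "list_all (\<lambda>i. list_all (\<lambda>j. if i = j then vertex_inner i j = (3, 0)
    else vertex_adj i j \<or> List.member [(1, 0), (-1, 0), (1, -2), (-3, 0)] (vertex_inner i j))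
    [0..<20]) [0..<20]"
    by code_simp
  then have "\<forall>i\<in>{0..<20}. \<forall>j\<in>{0..<20}. if i = j then vertex_inner i j = (3, 0)
    else vertex_adj i j \<or> List.member [(1, 0), (-1, 0), (1, -2), (-3, 0)] (vertex_inner i j)"
    by (simp only: list_all_iff set_upt)
  from bspec[OF bspec[OF this, of i], of j] assms show ?thesis
    by (simp split: if_splits)
qed

lemma vertex_norm: "i < 20 \<Longrightarrow> dodecahedron_vertex i \<bullet> dodecahedron_vertex i = 3"
  using vertex_inner_cases[of i i] by (simp add: inner_dodecahedron_vertex golden_int_def)

lemma inner_vertex_adj:
  "vertex_adj i j \<Longrightarrow> dodecahedron_vertex i \<bullet> dodecahedron_vertex j = 2 * golden_ratio - 1"
  by (simp add: vertex_adj_def inner_dodecahedron_vertex golden_int_def)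

lemma inner_vertex_le:
  assumes "i < 20" "j < 20" "i \<noteq> j"
  shows "dodecahedron_vertex i \<bullet> dodecahedron_vertex j \<le> 2 * golden_ratio - 1"
proof (cases "vertex_adj i j")
  case False
  then show ?thesis
    using vertex_inner_cases[of i j] assms golden_ratio_bounds
    by (auto simp: inner_dodecahedron_vertex golden_int_def)
qed (simp add: inner_vertex_adj)

text \<open>If distinct indices gave the same point, its squared norm 3 would be at most
  \<open>2 * golden_ratio - 1\<close>, which is less than 3.\<close>

lemma inj_dodecahedron_vertex: "inj_on dodecahedron_vertex {..<20}"
proof (rule inj_onI)
  fix i j assume "i \<in> {..<20::nat}" "j \<in> {..<20::nat}"
    and eq: "dodecahedron_vertex i = dodecahedron_vertex j"
  then show "i = j"
    using inner_vertex_le[of i j] vertex_norm[of i] golden_ratio_bounds by force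
qed

text \<open>A row \<open>(i, j, p, q, s, t)\<close> writes \<open>v i + v j\<close>, for non-adjacent vertices \<open>v i\<close> and \<open>v j\<close>, as
  \<open>(2 - golden_ratio) * (v p + v q) + (golden_ratio - 1) * (v s + v t)\<close>.\<close>

definition non_edge_table :: "(nat \<times> nat \<times> nat \<times> nat \<times> nat \<times> nat) list" where
  "non_edge_table =
    [(2, 1, 7, 4, 0, 0), (3, 1, 8, 5, 0, 0), (3, 2, 9, 6, 0, 0), (4, 0, 7, 2, 1, 1),
     (4, 2, 1, 0, 7, 7), (4, 3, 1, 0, 8, 7), (5, 0, 8, 3, 1, 1), (5, 2, 1, 0, 8, 7),
     (5, 3, 1, 0, 8, 8), (5, 4, 11, 10, 1, 1), (6, 0, 9, 3, 2, 2), (6, 1, 2, 0, 9, 4),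
     (6, 3, 2, 0, 9, 9), (6, 4, 1, 0, 12, 7), (6, 5, 1, 0, 12, 8), (7, 0, 4, 1, 2, 2),
     (7, 1, 2, 0, 4, 4), (7, 3, 1, 0, 12, 0), (7, 5, 1, 0, 16, 1), (7, 6, 13, 12, 2, 2),
     (8, 0, 5, 1, 3, 3), (8, 1, 3, 0, 5, 5), (8, 2, 1, 0, 15, 0), (8, 4, 1, 0, 17, 1),
     (8, 6, 1, 0, 15, 9), (8, 7, 1, 0, 10, 9), (9, 0, 6, 2, 3, 3), (9, 1, 2, 0, 14, 0),
     (9, 2, 3, 0, 6, 6), (9, 4, 1, 0, 15, 7), (9, 5, 1, 0, 15, 8), (9, 7, 1, 0, 12, 6),
     (9, 8, 15, 14, 3, 3), (10, 0, 4, 1, 11, 2), (10, 1, 11, 5, 4, 4), (10, 2, 1, 0, 16, 7),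
     (10, 3, 1, 0, 16, 8), (10, 5, 4, 1, 11, 11), (10, 6, 1, 0, 16, 12), (10, 7, 16, 13, 4, 4),
     (10, 8, 1, 0, 17, 11), (10, 9, 1, 0, 16, 15), (11, 0, 4, 1, 14, 1), (11, 1, 10, 4, 5, 5),
     (11, 2, 1, 0, 17, 7), (11, 3, 1, 0, 17, 8), (11, 4, 5, 1, 10, 10), (11, 6, 1, 0, 16, 15),
     (11, 7, 1, 0, 16, 10), (11, 8, 17, 14, 5, 5), (11, 9, 1, 0, 17, 15), (12, 0, 6, 2, 13, 3),
     (12, 1, 2, 0, 18, 4), (12, 2, 13, 7, 6, 6), (12, 3, 2, 0, 18, 9), (12, 4, 2, 0, 16, 13),
     (12, 5, 1, 0, 16, 15), (12, 7, 6, 2, 13, 13), (12, 8, 1, 0, 18, 15), (12, 9, 18, 15, 6, 6),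
     (12, 10, 7, 2, 19, 16), (12, 11, 2, 1, 19, 19), (13, 0, 4, 1, 12, 2), (13, 1, 2, 0, 16, 4),
     (13, 2, 12, 6, 7, 7), (13, 3, 2, 0, 16, 9), (13, 4, 16, 10, 7, 7), (13, 5, 2, 0, 16, 11),
     (13, 6, 7, 2, 12, 12), (13, 8, 1, 0, 16, 15), (13, 9, 2, 0, 18, 12), (13, 10, 7, 4, 16, 16),
     (13, 11, 4, 1, 19, 16), (14, 0, 5, 1, 15, 3), (14, 1, 3, 0, 17, 5), (14, 2, 3, 0, 17, 6),
     (14, 3, 15, 9, 8, 8), (14, 4, 2, 0, 17, 11), (14, 5, 17, 11, 8, 8), (14, 6, 3, 0, 18, 15),
     (14, 7, 1, 0, 16, 15), (14, 9, 8, 3, 15, 15), (14, 10, 5, 1, 19, 17), (14, 11, 8, 5, 17, 17),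
     (14, 12, 9, 3, 19, 18), (14, 13, 3, 2, 19, 19), (15, 0, 6, 2, 14, 3), (15, 1, 3, 0, 18, 5),
     (15, 2, 3, 0, 18, 6), (15, 3, 14, 8, 9, 9), (15, 4, 1, 0, 17, 12), (15, 5, 3, 0, 17, 14),
     (15, 6, 18, 12, 9, 9), (15, 7, 1, 0, 18, 12), (15, 8, 9, 3, 14, 14), (15, 10, 3, 1, 19, 19),
     (15, 11, 8, 3, 19, 17), (15, 12, 9, 6, 18, 18), (15, 13, 6, 2, 19, 18), (16, 0, 4, 1, 19, 2),
     (16, 1, 7, 2, 11, 10), (16, 2, 4, 1, 13, 12), (16, 3, 1, 0, 17, 12), (16, 4, 13, 7, 10, 10),
     (16, 5, 4, 1, 19, 11), (16, 6, 7, 2, 19, 12), (16, 7, 10, 4, 13, 13), (16, 8, 1, 0, 19, 17),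
     (16, 9, 2, 0, 19, 18), (16, 11, 19, 17, 10, 10), (16, 12, 19, 18, 13, 13), (16, 14, 10, 9, 19, 17),
     (16, 15, 10, 9, 19, 18), (17, 0, 5, 1, 19, 3), (17, 1, 8, 2, 11, 11), (17, 2, 1, 0, 16, 15),
     (17, 3, 5, 1, 15, 14), (17, 4, 5, 1, 19, 10), (17, 5, 14, 8, 11, 11), (17, 6, 3, 0, 19, 18),
     (17, 7, 1, 0, 19, 16), (17, 8, 11, 5, 14, 14), (17, 9, 8, 3, 19, 15), (17, 10, 19, 16, 11, 11),
     (17, 12, 10, 9, 19, 18), (17, 13, 10, 2, 19, 19), (17, 15, 19, 18, 14, 14), (17, 16, 11, 10, 19, 19),
     (18, 0, 6, 2, 19, 3), (18, 1, 2, 0, 16, 14), (18, 2, 9, 1, 12, 12), (18, 3, 6, 1, 15, 15),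
     (18, 4, 2, 0, 19, 16), (18, 5, 3, 0, 19, 17), (18, 6, 15, 9, 12, 12), (18, 7, 6, 2, 19, 13),
     (18, 8, 9, 3, 19, 14), (18, 9, 12, 6, 15, 15), (18, 10, 11, 6, 19, 16), (18, 11, 10, 9, 19, 17),
     (18, 13, 19, 16, 12, 12), (18, 14, 19, 17, 15, 15), (18, 16, 13, 12, 19, 19), (18, 17, 15, 14, 19, 19),
     (19, 0, 4, 1, 14, 12), (19, 1, 7, 2, 17, 11), (19, 2, 4, 1, 18, 12), (19, 3, 5, 1, 18, 15),
     (19, 4, 10, 9, 16, 10), (19, 5, 10, 0, 17, 17), (19, 6, 10, 9, 18, 12), (19, 7, 10, 4, 18, 13),
     (19, 8, 10, 9, 17, 14), (19, 9, 11, 6, 18, 15), (19, 10, 17, 11, 16, 16), (19, 11, 16, 10, 17, 17),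
     (19, 12, 16, 13, 18, 18), (19, 13, 18, 12, 16, 16), (19, 14, 18, 15, 17, 17), (19, 15, 17, 14, 18, 18)]"

lemma non_edge_table_correct:
  assumes "(i, j, p, q, s, t) \<in> set non_edge_table"
  shows "{p, q, s, t} \<subseteq> {..<20} - {i, j}"
    and "dodecahedron_vertex i + dodecahedron_vertex j =
      (1 - (golden_ratio - 1)) *\<^sub>R (dodecahedron_vertex p + dodecahedron_vertex q)
      + (golden_ratio - 1) *\<^sub>R (dodecahedron_vertex s + dodecahedron_vertex t)"
proof -
  let ?v = "(!) dodecahedron_coords"
  \<comment> \<open>The pairs \<open>(2, -1)\<close> and \<open>(-1, 1)\<close> encode the weights
    \<open>2 - golden_ratio\<close> and \<open>golden_ratio - 1\<close>, so each row becomes an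
    identity between integers.\<close>
  have "list_all (\<lambda>(i, j, p, q, s, t). list_all (\<lambda>m. m < 20 \<and> m \<noteq> i \<and> m \<noteq> j) [p, q, s, t] \<and>
    golden_vec_add (?v i) (?v j) = golden_vec_add (golden_scale (2, -1) (golden_vec_add (?v p) (?v q)))
      (golden_scale (-1, 1) (golden_vec_add (?v s) (?v t)))) non_edge_table"
    by code_simp
  then have row: "{p, q, s, t} \<subseteq> {..<20} - {i, j}"
    "golden_vec_add (?v i) (?v j) = golden_vec_add (golden_scale (2, -1) (golden_vec_add (?v p) (?v q)))
      (golden_scale (-1, 1) (golden_vec_add (?v s) (?v t)))"
    using assms by (auto simp: list_all_iff)
  show "{p, q, s, t} \<subseteq> {..<20} - {i, j}"
    by (rule row)
  show "dodecahedron_vertex i + dodecahedron_vertex j =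
      (1 - (golden_ratio - 1)) *\<^sub>R (dodecahedron_vertex p + dodecahedron_vertex q)
      + (golden_ratio - 1) *\<^sub>R (dodecahedron_vertex s + dodecahedron_vertex t)"
    using arg_cong[OF row(2), of golden_point]
    by (simp add: golden_point_add golden_point_scale dodecahedron_vertex_def golden_int_def)
qed

lemma non_edge_table_complete:
  assumes "j < i" "i < 20" "\<not> vertex_adj i j"
  shows "\<exists>p q s t. (i, j, p, q, s, t) \<in> set non_edge_table"
proof -
  \<comment> \<open>The rows are sorted by \<open>i\<close> and then by \<open>j\<close>, so
    completeness is an equality with the list of all non-adjacent pairs with
    \<open>j < i\<close>.\<close>
  have "map (\<lambda>(i, j, _). (i, j)) non_edge_table =
    concat (map (\<lambda>i. map (Pair i) (filter (\<lambda>j. \<not> vertex_adj i j) [0..<i])) [0..<20])"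
    by code_simp
  moreover have "(i, j) \<in> set \<dots>"
    using assms by (auto intro!: bexI[of _ i])
  ultimately have "(i, j) \<in> (\<lambda>(i, j, _). (i, j)) ` set non_edge_table"
    by (metis list.set_map)
  then show ?thesis
    by force
qed

lemma edge_of_regular_dodecahedron_iff:
  assumes ij: "i < 20" "j < 20"
  shows "closed_segment (dodecahedron_vertex i) (dodecahedron_vertex j) edge_of regular_dodecahedron
    \<longleftrightarrow> vertex_adj i j"
proof -
  let ?v = dodecahedron_vertex and ?S = "dodecahedron_vertex ` {..<20}"
  have fin: "finite ?S" and sphere: "\<And>x. x \<in> ?S \<Longrightarrow> x \<bullet> x = 3"
    using vertex_norm by auto
  have edge: "closed_segment (?v i) (?v j) edge_of convex hull ?S" if adj: "vertex_adj i j"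
  proof -
    have "i \<noteq> j"
      using adj vertex_inner_cases[of i j] ij by (auto simp: vertex_adj_def)
    moreover have "(?v i + ?v j) \<bullet> x < 3 + ?v i \<bullet> ?v j" if x: "x \<in> ?S" "x \<noteq> ?v i" "x \<noteq> ?v j" for x
    proof -
      obtain m where "x = ?v m" "m < 20" "m \<noteq> i" "m \<noteq> j"
        using x by auto
      \<comment> \<open>The left side is at most \<open>2 * sqrt 5\<close>, the right side equals
        \<open>3 + sqrt 5\<close>, and \<open>sqrt 5 < 3\<close>; here \<open>sqrt 5\<close> appears
        as \<open>2 * golden_ratio - 1\<close>.\<close>
      then show ?thesis
        using inner_vertex_le[of i m] inner_vertex_le[of j m] inner_vertex_adj[OF adj] ij
          golden_ratio_bounds by (simp add: inner_add_left)
    qed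
    ultimately show ?thesis
      using ij inj_dodecahedron_vertex
      by (intro closed_segment_edge_of_convex_hull_sphere[OF fin sphere]) (auto simp: inj_on_def)
  qed
  \<comment> \<open>The table covers only \<open>j < i\<close>; the opposite order follows from the
    symmetry of segments and of adjacency.\<close>
  have non_edge: "\<not> closed_segment (?v i) (?v j) edge_of convex hull ?S"
    if less: "j < i" "i < 20" and nonadj: "\<not> vertex_adj i j" for i j
  proof -
    obtain p q s t where row: "(i, j, p, q, s, t) \<in> set non_edge_table"
      using non_edge_table_complete[OF less nonadj] by blast
    have "{?v p, ?v q, ?v s, ?v t} \<subseteq> ?S - {?v i, ?v j}"
    proof -
      have "?v m \<in> ?S - {?v i, ?v j}" if "m \<in> {p, q, s, t}" for m
        using that non_edge_table_correct(1)[OF row] \<open>j < i\<close> \<open>i < 20\<close>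
          inj_on_eq_iff[OF inj_dodecahedron_vertex, of m i]
          inj_on_eq_iff[OF inj_dodecahedron_vertex, of m j] by auto
      from this[of p] this[of q] this[of s] this[of t] show ?thesis
        by simp
    qed
    then show ?thesis
      using less golden_ratio_bounds non_edge_table_correct(2)[OF row]
      by (intro not_closed_segment_edge_of_convex_hull[OF fin sphere,
            where c = "golden_ratio - 1"]) auto
  qed
  show ?thesis
  proof (cases i j rule: linorder_cases)
    \<comment> \<open>A degenerate segment has dimension 0 and is no edge, while a vertex has inner
      product 3 with itself and so is not adjacent to itself.\<close>
    case equal
    then show ?thesis
      using vertex_inner_cases[of i j] ij
      by (simp add: edge_of_def vertex_adj_def)
  next
    case less
    then show ?thesis
      using edge non_edge[of i j] ij vertex_adj_sym[of i j]
      by (metis closed_segment_commute non_edge regular_dodecahedron_eq)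
  next
    case greater
    then show ?thesis
      using edge non_edge[of j i] ij by (auto simp: regular_dodecahedron_eq)
  qed
qed

lemma dodecahedron_graph_eq:
  "dodecahedron_graph = \<lparr>pverts = dodecahedron_vertex ` {..<20},
    parcs = {(dodecahedron_vertex i, dodecahedron_vertex j) | i j. i < 20 \<and> j < 20 \<and> vertex_adj i j}\<rparr>"
proof -
  have extreme: "x extreme_point_of regular_dodecahedron \<longleftrightarrow> x \<in> dodecahedron_vertex ` {..<20}" for x
    using extreme_points_of_convex_hull_sphere[of "dodecahedron_vertex ` {..<20}" 3] vertex_norm
    unfolding regular_dodecahedron_eq by blast
  show ?thesis
    unfolding dodecahedron_graph_def polytope_graph_def extreme
    using edge_of_regular_dodecahedron_iff by auto
qed

lemma arc_dodecahedron_graph_iff: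
  assumes "i < 20" "j < 20"
  shows "(dodecahedron_vertex i, dodecahedron_vertex j) \<in> parcs dodecahedron_graph \<longleftrightarrow> vertex_adj i j"
proof
  assume "(dodecahedron_vertex i, dodecahedron_vertex j) \<in> parcs dodecahedron_graph"
  then obtain i' j' where "dodecahedron_vertex i = dodecahedron_vertex i'"
    "dodecahedron_vertex j = dodecahedron_vertex j'" "i' < 20" "j' < 20" "vertex_adj i' j'"
    unfolding dodecahedron_graph_eq by auto
  moreover from this have "i = i'" "j = j'"
    using assms by (auto intro: inj_onD[OF inj_dodecahedron_vertex])
  ultimately show "vertex_adj i j"
    by simp
next
  assume "vertex_adj i j"
  then show "(dodecahedron_vertex i, dodecahedron_vertex j) \<in> parcs dodecahedron_graph"
    unfolding dodecahedron_graph_eq using assms by auto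
qed

section \<open>Triangles, earlier neighbours and the number of edges\<close>

lemma vertex_adj_triangle_free:
  assumes "i < 20" "j < 20" "m < 20" "vertex_adj i j" "vertex_adj j m"
  shows "\<not> vertex_adj i m"
proof -
  \<comment> \<open>A triangle amounts to two adjacent vertices in the neighbourhood of a third, so
    only pairs of neighbours are compared instead of all triples.\<close>
  have "list_all (\<lambda>N. list_all (\<lambda>j. list_all (\<lambda>m. \<not> vertex_adj j m) N) N)
    (map (\<lambda>i. filter (vertex_adj i) [0..<20]) [0..<20])"
    by code_simp
  then have "\<forall>N \<in> (\<lambda>i. filter (vertex_adj i) [0..<20]) ` {0..<20}. \<forall>k \<in> set N. \<forall>l \<in> set N. \<not> vertex_adj k l"
    by (simp only: list_all_iff set_map set_upt)
  moreover have "filter (vertex_adj j) [0..<20] \<in> (\<lambda>i. filter (vertex_adj i) [0..<20]) ` {0..<20}"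
    using \<open>j < 20\<close> by (intro imageI) simp
  ultimately have "\<forall>k \<in> set (filter (vertex_adj j) [0..<20]).
      \<forall>l \<in> set (filter (vertex_adj j) [0..<20]). \<not> vertex_adj k l"
    by (rule bspec)
  moreover have "i \<in> set (filter (vertex_adj j) [0..<20])" "m \<in> set (filter (vertex_adj j) [0..<20])"
    using assms vertex_adj_sym[of i j] by (simp_all only: set_filter set_upt) auto
  ultimately show ?thesis
    by blast
qed

lemma vertex_adj_earlier:
  assumes "0 < i" "i < 20"
  shows "\<exists>j<i. vertex_adj j i"
proof -
  have "list_all (\<lambda>i. list_ex (\<lambda>j. vertex_adj j i) [0..<i]) [1..<20]"
    by code_simp
  with assms show ?thesis
    by (force simp: list_all_iff list_ex_iff)
qed

lemma card_vertex_adj: "card {(i, j). i < j \<and> j < 20 \<and> vertex_adj i j} = 30"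
proof -
  let ?L = "concat (map (\<lambda>j. map (\<lambda>i. (i, j)) (filter (\<lambda>i. vertex_adj i j) [0..<j])) [0..<20])"
  have "{(i, j). i < j \<and> j < 20 \<and> vertex_adj i j} = set ?L"
    by auto
  moreover have "distinct ?L \<and> length ?L = 30"
    by code_simp
  ultimately show ?thesis
    by (simp only: distinct_card)
qed

lemma card_parcs_dodecahedron_graph: "card (parcs dodecahedron_graph) = 60"
proof -
  let ?E = "{(i, j). i < j \<and> j < 20 \<and> vertex_adj i j}"
  let ?v = "map_prod dodecahedron_vertex dodecahedron_vertex"
  have irrefl: "\<not> vertex_adj i i" if "i < 20" for i
    using vertex_inner_cases[of i i] that by (simp add: vertex_adj_def)
  have "parcs dodecahedron_graph = ?v ` {(i, j). i < 20 \<and> j < 20 \<and> vertex_adj i j}"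
    by (auto simp: dodecahedron_graph_eq map_prod_def image_iff)
  \<comment> \<open>The arcs correspond to the 30 increasing index pairs and their reversals, two
    disjoint sets.\<close>
  also have "{(i, j). i < 20 \<and> j < 20 \<and> vertex_adj i j} = ?E \<union> prod.swap ` ?E"
    using irrefl vertex_adj_sym by (auto simp: image_iff) (metis linorder_neqE_nat)
  finally have "parcs dodecahedron_graph = ?v ` (?E \<union> prod.swap ` ?E)" .
  moreover have "inj_on ?v (?E \<union> prod.swap ` ?E)"
    by (rule inj_on_subset[OF map_prod_inj_on[OF inj_dodecahedron_vertex inj_dodecahedron_vertex]]) auto
  moreover have "finite ?E"
    by (rule finite_subset[of _ "{..<20} \<times> {..<20}"]) auto
  then have "card (?E \<union> prod.swap ` ?E) = card ?E + card ?E"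
    by (subst card_Un_disjoint) (auto simp: card_image)
  ultimately show ?thesis
    by (simp only: card_image card_vertex_adj)
qed

theorem theorem2p4:
  shows "competition_number dodecahedron_graph = 12"
  unfolding competition_number_def
proof (rule Least_equality)
  let ?v = dodecahedron_vertex
  have bij: "bij_betw ?v {..<20} (pverts dodecahedron_graph)"
    using inj_dodecahedron_vertex by (simp add: bij_betw_def dodecahedron_graph_eq)
  have card_verts: "card (pverts dodecahedron_graph) = 20"
    using bij_betw_same_card[OF bij] by simp
  have arcs_subset: "parcs dodecahedron_graph \<subseteq> pverts dodecahedron_graph \<times> pverts dodecahedron_graph"
    by (auto simp: dodecahedron_graph_eq)
  have sym_arcs: "(y, x) \<in> parcs dodecahedron_graph" if "(x, y) \<in> parcs dodecahedron_graph" for x y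
    using that vertex_adj_sym by (auto simp: dodecahedron_graph_eq)
  have triangle_free: "(x, z) \<notin> parcs dodecahedron_graph"
    if xy: "(x, y) \<in> parcs dodecahedron_graph" and yz: "(y, z) \<in> parcs dodecahedron_graph" for x y z
  proof -
    obtain i j m where "x = ?v i" "y = ?v j" "z = ?v m" "i < 20" "j < 20" "m < 20"
      using xy yz arcs_subset by (force simp: dodecahedron_graph_eq)
    then show ?thesis
      using xy yz vertex_adj_triangle_free[of i j m] arc_dodecahedron_graph_iff by auto
  qed
  show "\<exists>D. pair_digraph D \<and> acyclic (parcs D) \<and> competition_graph D = add_isolated 12 dodecahedron_graph"
  proof (rule competition_graph_if_connected_ordering[OF bij arcs_subset sym_arcs])
    \<comment> \<open>A loop would be a triangle with all three corners equal.\<close>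
    show "(x, x) \<notin> parcs dodecahedron_graph" for x
      using triangle_free by blast
    show "\<exists>j<i. (?v j, ?v i) \<in> parcs dodecahedron_graph" if "0 < i" "i < 20" for i
      using vertex_adj_earlier[OF that] that arc_dodecahedron_graph_iff by (meson less_trans)
    have "{(i, j). i < j \<and> j < 20 \<and> (?v i, ?v j) \<in> parcs dodecahedron_graph}
        = {(i, j). i < j \<and> j < 20 \<and> vertex_adj i j}"
      using arc_dodecahedron_graph_iff by (metis less_trans)
    then show "card {(i, j). i < j \<and> j < 20 \<and> (?v i, ?v j) \<in> parcs dodecahedron_graph} + 2 = 20 + 12"
      by (simp add: card_vertex_adj)
  qed simp_all
  show "12 \<le> k"
    if "\<exists>D. pair_digraph D \<and> acyclic (parcs D) \<and> competition_graph D = add_isolated k dodecahedron_graph"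
    for k
  proof -
    from that obtain D where "pair_digraph D" "acyclic (parcs D)"
      "competition_graph D = add_isolated k dodecahedron_graph"
      by blast
    then have "card (parcs dodecahedron_graph) \<le> 2 * (card (pverts dodecahedron_graph) + k - 2)"
      using card_verts by (intro card_parcs_le_if_competition_graph triangle_free)
        (auto simp: dodecahedron_graph_eq)
    \<comment> \<open>The bound reads \<open>60 \<le> 2 * (20 + k - 2)\<close>.\<close>
    then show ?thesis
      by (simp add: card_verts card_parcs_dodecahedron_graph)
  qed
qed

end
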